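(* The efficient frontier (EF) of the multiobjective problem is a (possibly strict) subset of the boundary of the epigraph of the restricted value function $z$, where a criterion vector $(\gamma_0,\gamma_1,\dots,\gamma_\ell)$ is identified with the point $((\gamma_1,\dots,\gamma_\ell),\gamma_0)\in\mathbb{R}^\ell\times\mathbb{R}$. In particular, the following statements hold. 1. If $C_Ix_I+C_Cx_C$ belongs to the EF for some $(x_I,x_C)\in X_{\rm MO}$, then $(C_I^{1:\ell}x_I+C_C^{1:\ell}x_C,\ c^0_Ix_I+c^0_Cx_C)$ is a point on the boundary of the epigraph of $z$ (that is, $z(C_I^{1:\ell}x_I+C_C^{1:\ell}x_C)=c^0_Ix_I+c^0_Cx_C$). 2. If $(\zeta,z(\zeta))$ (with $\zeta\in\mathcal{C}$) is a point on the boundary of the epigraph of $z$, then there exists an efficient solution $(x_I,x_C)\in X_{\rm MO}$ such that $c^0_Ix_I+c^0_Cx_C=z(\zeta)$ and $C_I^{1:\ell}x_I+C_C^{1:\ell}x_C\le\zeta$. Further, for this solution, $C_I^{1:\ell}x_I+C_C^{1:\ell}x_C=\zeta$ if and only if $\nabla_dz(\zeta)>0$ for all $d\in\mathbb{R}^\ell_-\setminus\{\mathbf{0}\}$.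
   Context: Data: $A\in\mathbb{Q}^{m\times n}$, $b\in\mathbb{Q}^m$, and $C\in\mathbb{Q}^{(\ell+1)\times n}$ with rows $c^0,c^1,\dots,c^\ell$; $C^{1:\ell}$ is the submatrix of $C$ with rows $c^1,\dots,c^\ell$. The first $r$ variables are integer and the last $n-r$ are continuous; a subscript $I$ (resp. $C$) on a matrix or row vector denotes its columns corresponding to the integer (resp. continuous) variables. The set $X_{\rm MO}=\{(x_I,x_C)\in\mathbb{Z}_+^r\times\mathbb{R}_+^{n-r}: A_Ix_I+A_Cx_C=b\}$ is assumed bounded. The multiobjective problem is the vector minimization of $C_Ix_I+C_Cx_C\in\mathbb{R}^{\ell+1}$ over $X_{\rm MO}$. A point $C_Ix_I+C_Cx_C$ with $(x_I,x_C)\in X_{\rm MO}$ dominates $C_Ix_I'+C_Cx_C'$ with $(x_I',x_C')\in X_{\rm MO}$ if it is componentwise $\le$ and strictly smaller in at least one component. A nondominated point (NDP) is a criterion vector of a feasible solution that is dominated by no other such vector; the EF is the set of all NDPs; a solution $(x_I,x_C)\in X_{\rm MO}$ whose criterion vector is an NDP is called efficient. For $\zeta\in\mathbb{R}^\ell$ let $\mathcal{S}(\zeta)=\{(x_I,x_C)\in X_{\rm MO}: C_I^{1:\ell}x_I+C_C^{1:\ell}x_C\le\zeta\}$ and $\mathcal{C}=\{\zeta\in\mathbb{R}^\ell:\mathcal{S}(\zeta)\ne\emptyset\}$. The restricted value function is $z(\zeta)=\inf_{(x_I,x_C)\in\mathcal{S}(\zeta)}c^0_Ix_I+c^0_Cx_C$,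 with $z(\zeta)=+\infty$ for $\zeta\notin\mathcal{C}$. By points on the boundary of the epigraph of $z$ the paper means points of the graph, i.e. points $(\zeta,z(\zeta))$ with $\zeta\in\mathcal{C}$. The directional derivative is $\nabla_dz(\zeta)=\lim_{t\searrow0}\frac{z(\zeta+td)-z(\zeta)}{t}$, which is allowed to take the value $+\infty$ (which counts as $>0$), e.g. when $z$ jumps or becomes $+\infty$ in direction $d$. *)

theory Defs
  imports "HOL-Analysis.Analysis"
begin

text \<open>
  Variables are indexed by \<open>'n\<close>, equality constraints by \<open>'m\<close>, and the objectives
  by \<open>'l option\<close>: \<open>None\<close> is objective 0 and \<open>Some k\<close>, for \<open>k :: 'l\<close>, are the
  objectives 1 to l. The integer variables are those with index in a set \<open>I\<close>, which
  is arbitrary (possibly empty or everything); the order of the variables plays no role.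
  On \<open>real ^ 'k\<close>, the library order \<open>\<le>\<close> is the componentwise one.
\<close>

definition rational_vec :: "real ^ 'k \<Rightarrow> bool" where
  "rational_vec v \<longleftrightarrow> (\<forall>i. v $ i \<in> \<rat>)"

definition rational_mat :: "real ^ 'k ^ 'j \<Rightarrow> bool" where
  "rational_mat M \<longleftrightarrow> (\<forall>i j. M $ i $ j \<in> \<rat>)"

definition X_MO :: "real ^ 'n ^ 'm \<Rightarrow> real ^ 'm \<Rightarrow> 'n set \<Rightarrow> (real ^ 'n) set" where
  "X_MO A b I = {x. A *v x = b \<and> (\<forall>j. 0 \<le> x $ j) \<and> (\<forall>j\<in>I. x $ j \<in> \<int>)}"

definition mo_instance ::
  "real ^ 'n ^ 'm \<Rightarrow> real ^ 'm \<Rightarrow> 'n set \<Rightarrow> real ^ 'n ^ ('l::finite) option \<Rightarrow> bool" where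
  "mo_instance A b I C \<longleftrightarrow>
     rational_mat A \<and> rational_vec b \<and> rational_mat C \<and> bounded (X_MO A b I)"

definition obj0 :: "real ^ 'n ^ ('l::finite) option \<Rightarrow> real ^ 'n \<Rightarrow> real" where
  "obj0 C x = C $ None \<bullet> x"

definition rows1l :: "real ^ 'n ^ ('l::finite) option \<Rightarrow> real ^ 'n ^ 'l" where
  "rows1l C = (\<chi> k. C $ Some k)"

definition dominates :: "real ^ 'k \<Rightarrow> real ^ 'k \<Rightarrow> bool" where
  "dominates u v \<longleftrightarrow> (\<forall>i. u $ i \<le> v $ i) \<and> (\<exists>i. u $ i < v $ i)"

definition efficient_frontier ::
  "real ^ 'n ^ 'm \<Rightarrow> real ^ 'm \<Rightarrow> 'n set \<Rightarrow> real ^ 'n ^ ('l::finite) option \<Rightarrow> (real ^ ('l::finite) option) set" where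
  "efficient_frontier A b I C =
     {C *v x | x. x \<in> X_MO A b I \<and> \<not> (\<exists>x'\<in>X_MO A b I. dominates (C *v x') (C *v x))}"

definition efficient ::
  "real ^ 'n ^ 'm \<Rightarrow> real ^ 'm \<Rightarrow> 'n set \<Rightarrow> real ^ 'n ^ ('l::finite) option \<Rightarrow> real ^ 'n \<Rightarrow> bool" where
  "efficient A b I C x \<longleftrightarrow> x \<in> X_MO A b I \<and> C *v x \<in> efficient_frontier A b I C"

definition feas ::
  "real ^ 'n ^ 'm \<Rightarrow> real ^ 'm \<Rightarrow> 'n set \<Rightarrow> real ^ 'n ^ ('l::finite) option \<Rightarrow> real ^ 'l \<Rightarrow> (real ^ 'n) set" where
  "feas A b I C \<zeta> = {x \<in> X_MO A b I. rows1l C *v x \<le> \<zeta>}"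

definition vf_dom ::
  "real ^ 'n ^ 'm \<Rightarrow> real ^ 'm \<Rightarrow> 'n set \<Rightarrow> real ^ 'n ^ ('l::finite) option \<Rightarrow> (real ^ 'l) set" where
  "vf_dom A b I C = {\<zeta>. feas A b I C \<zeta> \<noteq> {}}"

text \<open>The infimum of the empty set in \<open>ereal\<close> is \<open>\<infinity>\<close>, the value required outside
  \<open>vf_dom\<close>.\<close>

definition rvf ::
  "real ^ 'n ^ 'm \<Rightarrow> real ^ 'm \<Rightarrow> 'n set \<Rightarrow> real ^ 'n ^ ('l::finite) option \<Rightarrow> real ^ 'l \<Rightarrow> ereal" where
  "rvf A b I C \<zeta> = (INF x\<in>feas A b I C \<zeta>. ereal (obj0 C x))"

text \<open>``Boundary of the epigraph'' means the graph over \<open>vf_dom\<close>, not the topological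
  boundary, which may also contain vertical pieces where the value function jumps.\<close>

definition epi_boundary ::
  "real ^ 'n ^ 'm \<Rightarrow> real ^ 'm \<Rightarrow> 'n set \<Rightarrow> real ^ 'n ^ ('l::finite) option \<Rightarrow> ((real ^ 'l) \<times> real) set" where
  "epi_boundary A b I C = {(\<zeta>, w). \<zeta> \<in> vf_dom A b I C \<and> rvf A b I C \<zeta> = ereal w}"

definition as_epi_point :: "real ^ ('l::finite) option \<Rightarrow> (real ^ 'l) \<times> real" where
  "as_epi_point \<gamma> = ((\<chi> k. \<gamma> $ Some k), \<gamma> $ None)"

text \<open>One-sided directional derivative at a point where \<open>f\<close> is finite; the limit is taken
  in \<open>ereal\<close>, so \<open>D = \<infinity>\<close> is allowed.\<close>

definition has_dir_deriv :: "(real ^ 'l \<Rightarrow> ereal) \<Rightarrow> real ^ 'l \<Rightarrow> real ^ 'l \<Rightarrow> ereal \<Rightarrow> bool" where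
  "has_dir_deriv f \<zeta> d D \<longleftrightarrow>
     ((\<lambda>t::real. (f (\<zeta> + t *\<^sub>R d) - f \<zeta>) / ereal t) \<longlongrightarrow> D) (at_right 0)"

end

theory Submission
  imports Defs "HOL-Real_Asymp.Real_Asymp"
begin

text \<open>
  An efficient solution lies on the graph of the restricted value function because a cheaper
  feasible point for its own right-hand side would dominate it. Conversely, a solution that
  minimizes objective 0 over the feasible set of \<open>\<zeta>\<close> and, among the minimizers,
  the sum of the remaining objectives is efficient; both minima are attained because the feasible
  set is compact (\<open>efficient_minimizer_exists\<close>). The inclusion of the frontier in the
  graph is strict as soon as some bound \<open>\<zeta>\<close> on the graph is slack for every
  solution, as for a one-point feasible set with zero objectives.

  Let \<open>x\<close> be an efficient solution attaining the value at \<open>\<zeta>\<close>. Let \<open>v\<close> be its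
  vector of objectives 1 to l. If \<open>v \<noteq> \<zeta>\<close>, then moving \<open>\<zeta>\<close> towards \<open>v\<close> keeps
  \<open>x\<close> feasible, so the value stays constant and the directional derivative is
  zero (\<open>dir_deriv_towards_slack_zero\<close>). If \<open>v = \<zeta>\<close>, then efficiency
  makes the value strictly larger at every \<open>\<zeta> + t d\<close> with \<open>t > 0\<close>, \<open>d \<le> 0\<close> and
  \<open>d \<noteq> 0\<close>. A strict increase alone would not give a derivative, let alone a positive one; this
  needs the polyhedral structure. Since the feasible set is bounded, only finitely many integer
  parts occur. For each of them, the pairs \<open>(t, cost)\<close> with \<open>0 \<le> t \<le> 1\<close> form a polytope in the
  plane (\<open>polytope_ray_costs\<close>), being the projection of a bounded polyhedron, and near \<open>t = 0\<close>
  the lower boundary of such a polytope is affine or infinite (\<open>polytope_near_left_edge\<close>).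
  An affine function that exceeds its value at 0 has positive slope, and one that starts above the
  value at \<open>\<zeta>\<close> has an infinite difference quotient in the limit. The value along the ray is the
  finite minimum of these lower boundaries, and difference quotients commute with minima
  (\<open>INF_slope_positive\<close>).
\<close>

section \<open>Lower boundary of a planar polytope\<close>

definition lower_boundary :: "(real \<times> real) set \<Rightarrow> real \<Rightarrow> ereal" where
  "lower_boundary Q t = (INF w\<in>{w. (t, w) \<in> Q}. ereal w)"

text \<open>
  The polytope is the hull of finitely many vertices. If all of them have first coordinate 0, or
  all have a positive one, there is nothing immediately to the right of the line \<open>t = 0\<close>.
  Otherwise, the lowest vertex on that line is the left end of a lower edge, whose right end is the
  vertex seen from it under the smallest slope: every vertex, hence the hull, lies above the line
  through these two vertices, and the hull contains the segment between them.
\<close>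

lemma polytope_near_left_edge:
  fixes Q :: "(real \<times> real) set"
  assumes "polytope Q" and nonneg: "Q \<subseteq> {0..} \<times> UNIV"
  obtains (empty) \<delta> where "\<delta> > 0" "\<And>t w. 0 < t \<Longrightarrow> t < \<delta> \<Longrightarrow> (t, w) \<notin> Q"
  | (affine) w\<^sub>0 s \<delta> where "\<delta> > 0"
      "\<And>t w. (t, w) \<in> Q \<Longrightarrow> w\<^sub>0 + s * t \<le> w"
      "\<And>t. 0 \<le> t \<Longrightarrow> t \<le> \<delta> \<Longrightarrow> (t, w\<^sub>0 + s * t) \<in> Q"
proof -
  obtain V where "finite V" and Q: "Q = convex hull V"
    using \<open>polytope Q\<close> unfolding polytope_def by blast
  have VQ: "V \<subseteq> Q"
    unfolding Q by (rule hull_subset)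
  define V0 where "V0 = {v \<in> V. fst v = 0}"
  define V1 where "V1 = {v \<in> V. 0 < fst v}"
  have fin: "finite V0" "finite V1"
    using \<open>finite V\<close> by (auto simp: V0_def V1_def)
  have V: "v \<in> V0 \<or> v \<in> V1" if "v \<in> V" for v
    using that VQ nonneg by (force simp: V0_def V1_def)
  consider "V0 = {}" | "V1 = {}" | "V0 \<noteq> {}" "V1 \<noteq> {}"
    by blast
  then show thesis
  proof cases
    case 1
    then obtain \<delta> where \<delta>: "\<delta> > 0" "\<And>v. v \<in> V \<Longrightarrow> \<delta> \<le> fst v"
    proof (cases "V = {}")
      case False
      have "Min (fst ` V) \<in> fst ` V"
        using False \<open>finite V\<close> by (intro Min_in) auto
      moreover have "fst v > 0" if "v \<in> V" for v
        using V[OF that] 1 by (simp add: V1_def)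
      ultimately have "Min (fst ` V) > 0"
        by auto
      then show thesis
        using that[of "Min (fst ` V)"] \<open>finite V\<close> by simp
    qed (use that[of 1] in auto)
    have "Q \<subseteq> {q. (1, 0) \<bullet> q \<ge> \<delta>}"
      unfolding Q by (intro hull_minimal convex_halfspace_ge) (use \<delta>(2) in auto)
    then show thesis
      using \<delta>(1) by (intro empty[of \<delta>]) auto
  next
    case 2
    have "Q \<subseteq> {q. (1, 0) \<bullet> q \<le> 0}"
      unfolding Q by (intro hull_minimal convex_halfspace_le) (use V 2 in \<open>fastforce simp: V0_def\<close>)
    then show thesis
      by (intro empty[of 1]) auto
  next
    case 3
    define w\<^sub>0 where "w\<^sub>0 = Min (snd ` V0)"
    define s where "s = Min ((\<lambda>v. (snd v - w\<^sub>0) / fst v) ` V1)"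
    have "w\<^sub>0 \<in> snd ` V0"
      unfolding w\<^sub>0_def using 3 fin by (intro Min_in) auto
    then have w0: "(0, w\<^sub>0) \<in> Q"
      using VQ by (auto simp: V0_def)
    have "s \<in> (\<lambda>v. (snd v - w\<^sub>0) / fst v) ` V1"
      unfolding s_def using 3 fin by (intro Min_in) auto
    then obtain v where v: "v \<in> V1" "s = (snd v - w\<^sub>0) / fst v"
      by blast
    define \<delta> where "\<delta> = fst v"
    have "\<delta> > 0"
      using v by (auto simp: \<delta>_def V1_def)
    then have "snd v = w\<^sub>0 + s * \<delta>"
      using v by (simp add: \<delta>_def)
    then have "v = (\<delta>, w\<^sub>0 + s * \<delta>)"
      by (simp add: \<delta>_def prod_eq_iff)
    then have v1: "(\<delta>, w\<^sub>0 + s * \<delta>) \<in> Q"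
      using v(1) VQ by (auto simp: V1_def)
    show thesis
    proof (rule affine[of \<delta> w\<^sub>0 s])
      have below: "w\<^sub>0 \<le> snd u - s * fst u" if "u \<in> V" for u
      proof (cases "u \<in> V0")
        case True
        then show ?thesis
          using fin unfolding w\<^sub>0_def by (auto simp: V0_def)
      next
        case False
        with V[OF that] have u: "u \<in> V1" "fst u > 0"
          by (auto simp: V1_def)
        then have "s \<le> (snd u - w\<^sub>0) / fst u"
          using fin unfolding s_def by auto
        then show ?thesis
          using u by (simp add: pos_le_divide_eq)
      qed
      \<comment> \<open>the half-plane above the line \<open>w = w\<^sub>0 + s t\<close>\<close>
      have "Q \<subseteq> {q. (- s, 1) \<bullet> q \<ge> w\<^sub>0}"
        unfolding Q by (intro hull_minimal convex_halfspace_ge) (use below in \<open>auto simp: inner_prod_def\<close>)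
      then show "w\<^sub>0 + s * t \<le> w" if "(t, w) \<in> Q" for t w
        using that by auto
      show "(t, w\<^sub>0 + s * t) \<in> Q" if "0 \<le> t" "t \<le> \<delta>" for t
      proof -
        have "(1 - t / \<delta>) *\<^sub>R (0, w\<^sub>0) + (t / \<delta>) *\<^sub>R (\<delta>, w\<^sub>0 + s * \<delta>) \<in> Q"
          using w0 v1 that \<open>\<delta> > 0\<close> polytope_imp_convex[OF \<open>polytope Q\<close>]
          by (intro convexD) auto
        also have "(1 - t / \<delta>) *\<^sub>R (0, w\<^sub>0) + (t / \<delta>) *\<^sub>R (\<delta>, w\<^sub>0 + s * \<delta>) = (t, w\<^sub>0 + s * t)"
          using \<open>\<delta> > 0\<close> by (simp add: field_simps)
        finally show ?thesis .
      qed
    qed (fact \<open>\<delta> > 0\<close>)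
  qed
qed

text \<open>
  The reference value \<open>z\<close> may lie strictly below the polytope at \<open>t = 0\<close>. This
  is needed because one integer part need not attain the minimum over all of them; its difference
  quotient then tends to \<open>\<infinity>\<close>.
\<close>

lemma lower_boundary_slope_positive:
  fixes Q :: "(real \<times> real) set" and z :: real
  assumes "polytope Q" and nonneg: "Q \<subseteq> {0..} \<times> UNIV"
    and ge: "\<And>w. (0, w) \<in> Q \<Longrightarrow> z \<le> w"
    and gt: "\<And>t w. (t, w) \<in> Q \<Longrightarrow> 0 < t \<Longrightarrow> z < w"
  obtains D where "D > 0"
    "((\<lambda>t. (lower_boundary Q t - ereal z) / ereal t) \<longlongrightarrow> D) (at_right 0)"
  using \<open>polytope Q\<close> nonneg
proof (cases rule: polytope_near_left_edge)
  case (empty \<delta>)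
  have "eventually (\<lambda>t. (lower_boundary Q t - ereal z) / ereal t = \<infinity>) (at_right 0)"
    using eventually_at_right_less[of 0] eventually_at_right_real[OF empty(1)]
  proof eventually_elim
    case (elim t)
    with empty(2) have "{w. (t, w) \<in> Q} = {}"
      by auto
    then show ?case
      using elim by (simp add: lower_boundary_def top_ereal_def)
  qed
  then show thesis
    using that[of \<infinity>] by (simp add: tendsto_eventually)
next
  case (affine w\<^sub>0 s \<delta>)
  have z: "z \<le> w\<^sub>0"
    using ge affine(1) affine(3)[of 0] by auto
  have quot: "eventually (\<lambda>t. ereal ((w\<^sub>0 - z) / t + s) =
      (lower_boundary Q t - ereal z) / ereal t) (at_right 0)"
    using eventually_at_right_less[of 0] eventually_at_right_real[OF affine(1)]
  proof eventually_elim
    case (elim t)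
    have "lower_boundary Q t = ereal (w\<^sub>0 + s * t)"
      unfolding lower_boundary_def
      by (rule antisym) (use affine elim in \<open>auto intro!: INF_lower INF_greatest\<close>)
    then show ?case
      using elim by (simp add: field_simps)
  qed
  show thesis
  proof (cases "w\<^sub>0 = z")
    case True
    have "z < w\<^sub>0 + s * \<delta>"
      using gt affine(1) affine(3)[of \<delta>] by auto
    then have "s > 0"
      using True affine(1) by (simp add: zero_less_mult_iff)
    moreover have "((\<lambda>t. (lower_boundary Q t - ereal z) / ereal t) \<longlongrightarrow> ereal s) (at_right 0)"
      by (rule Lim_transform_eventually[OF _ quot]) (simp add: True)
    ultimately show thesis
      using that[of "ereal s"] by simp
  next
    case False
    have "filterlim (\<lambda>t. (w\<^sub>0 - z) / t + s) at_top (at_right 0)"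
      using False z by real_asymp
    then have "((\<lambda>t. ereal ((w\<^sub>0 - z) / t + s)) \<longlongrightarrow> \<infinity>) (at_right 0)"
      by (simp add: tendsto_PInfty_eq_at_top)
    then show thesis
      using that[of \<infinity>] Lim_transform_eventually[OF _ quot] by simp
  qed
qed

text \<open>
  For \<open>t > 0\<close> the map \<open>y \<mapsto> (y - z) / t\<close> is monotone and so commutes with minima, and
  minima of finitely many limits are limits of minima. For an empty index set, the infimum and
  the limit are \<open>\<infinity>\<close>.
\<close>

lemma INF_slope_positive:
  fixes g :: "'a \<Rightarrow> real \<Rightarrow> ereal" and z :: real
  assumes "finite K"
    and "\<And>p. p \<in> K \<Longrightarrow> \<exists>D>0. ((\<lambda>t. (g p t - ereal z) / ereal t) \<longlongrightarrow> D) (at_right 0)"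
  shows "\<exists>D>0. ((\<lambda>t. ((INF p\<in>K. g p t) - ereal z) / ereal t) \<longlongrightarrow> D) (at_right 0)"
  using assms
proof (induction K)
  case empty
  have "eventually (\<lambda>t. ((INF p\<in>{}. g p t) - ereal z) / ereal t = \<infinity>) (at_right 0)"
    using eventually_at_right_less[of 0] by eventually_elim (simp add: top_ereal_def)
  then show ?case
    by (intro exI[of _ \<infinity>] conjI tendsto_eventually) simp_all
next
  case (insert p K)
  define q where "q = (\<lambda>(h :: real \<Rightarrow> ereal) t. (h t - ereal z) / ereal t)"
  obtain D where D: "D > 0" "(q (g p) \<longlongrightarrow> D) (at_right 0)"
    using insert.prems[of p] by (auto simp: q_def)
  have "\<exists>E>0. (q (\<lambda>t. INF p\<in>K. g p t) \<longlongrightarrow> E) (at_right 0)"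
    unfolding q_def by (rule insert.IH) (rule insert.prems, simp)
  then obtain E where E: "E > 0" "(q (\<lambda>t. INF p\<in>K. g p t) \<longlongrightarrow> E) (at_right 0)"
    by blast
  have "eventually (\<lambda>t. min (q (g p) t) (q (\<lambda>t. INF p\<in>K. g p t) t)
      = q (\<lambda>t. INF p\<in>insert p K. g p t) t) (at_right 0)"
    using eventually_at_right_less[of 0]
  proof eventually_elim
    case (elim t)
    have "mono (\<lambda>y. (y - ereal z) / ereal t)"
      using elim by (intro monoI ereal_divide_right_mono ereal_minus_mono) auto
    from min_of_mono[OF this] show ?case
      by (simp add: q_def inf_min)
  qed
  with tendsto_min[OF D(2) E(2)]
  have "(q (\<lambda>t. INF p\<in>insert p K. g p t) \<longlongrightarrow> min D E) (at_right 0)"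
    by (rule Lim_transform_eventually)
  then show ?case
    using D(1) E(1) unfolding q_def by (intro exI[of _ "min D E"]) simp
qed

section \<open>Integer fibres\<close>

text \<open>
  The representatives are chosen inside \<open>X\<close>, so that the values prescribed on \<open>I\<close>
  are integers for each of them; fixing them then makes the integrality conditions hold
  automatically.
\<close>

lemma finite_integer_representatives:
  fixes X :: "(real ^ 'n) set"
  assumes "bounded X" and int: "\<And>x j. x \<in> X \<Longrightarrow> j \<in> I \<Longrightarrow> x $ j \<in> \<int>"
  obtains K where "finite K" "K \<subseteq> X" "\<And>x. x \<in> X \<Longrightarrow> \<exists>p\<in>K. \<forall>j\<in>I. x $ j = p $ j"
proof -
  obtain B where B: "\<And>x. x \<in> X \<Longrightarrow> norm x \<le> B"
    using \<open>bounded X\<close> bounded_iff by blast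
  define f where "f = (\<lambda>x :: real ^ 'n. restrict (vec_nth x) I)"
  have "f ` X \<subseteq> (\<Pi>\<^sub>E j\<in>I. {y \<in> \<int>. \<bar>y\<bar> \<le> B})"
    using int B component_le_norm_cart order_trans unfolding f_def by (fastforce intro!: restrict_PiE_iff[THEN iffD2])
  then have "finite (f ` X)"
    by (rule finite_subset) (intro finite_PiE finite_abs_int_segment finite)
  then obtain K where K: "K \<subseteq> X" "finite K" "f ` X = f ` K"
    using finite_subset_image[of "f ` X" f X] by auto
  show thesis
  proof (rule that[OF K(2,1)])
    fix x assume "x \<in> X"
    then obtain p where p: "p \<in> K" "f x = f p"
      using K(3) by (metis imageE imageI)
    have "x $ j = p $ j" if "j \<in> I" for j
      using fun_cong[OF p(2), of j] that by (simp add: f_def)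
    then show "\<exists>p\<in>K. \<forall>j\<in>I. x $ j = p $ j"
      using p(1) by blast
  qed
qed

text \<open>
  The costs attainable at the points \<open>\<zeta> + t d\<close> by solutions with the integer part of
  \<open>p\<close>. The cut at \<open>t = 1\<close> makes this set bounded; only small \<open>t\<close> matter.
\<close>

definition ray_costs ::
  "real ^ 'n ^ 'm \<Rightarrow> real ^ 'm \<Rightarrow> 'n set \<Rightarrow> real ^ 'n ^ ('l::finite) option \<Rightarrow>
   real ^ 'l \<Rightarrow> real ^ 'l \<Rightarrow> real ^ 'n \<Rightarrow> (real \<times> real) set" where
  "ray_costs A b I C \<zeta> d p =
     {(t, obj0 C x) | t x. 0 \<le> t \<and> t \<le> 1 \<and> x \<in> feas A b I C (\<zeta> + t *\<^sub>R d) \<and>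
        (\<forall>j\<in>I. x $ j = p $ j)}"

text \<open>
  Once the integer coordinates are fixed, the pairs \<open>(x, t)\<close> satisfy a finite system of linear
  constraints: the bound \<open>\<zeta> + t d\<close> is affine in \<open>t\<close>. The costs are a linear image
  of this bounded polyhedron.
\<close>

lemma polytope_ray_costs:
  assumes "bounded (X_MO A b I)" and p: "p \<in> X_MO A b I"
  shows "polytope (ray_costs A b I C \<zeta> d p)"
proof -
  define P where "P = {(x, t). 0 \<le> t \<and> t \<le> 1 \<and> x \<in> feas A b I C (\<zeta> + t *\<^sub>R d) \<and>
    (\<forall>j\<in>I. x $ j = p $ j)}"
  have "P = {q. (0, 1) \<bullet> q \<ge> 0} \<inter> {q. (0, 1) \<bullet> q \<le> 1}
    \<inter> (\<Inter>i. {q. (A $ i, 0) \<bullet> q = b $ i})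
    \<inter> (\<Inter>j. {q. (axis j 1, 0) \<bullet> q \<ge> 0})
    \<inter> (\<Inter>j\<in>I. {q. (axis j 1, 0) \<bullet> q = p $ j})
    \<inter> (\<Inter>k. {q. (C $ Some k, - (d $ k)) \<bullet> q \<le> \<zeta> $ k})" (is "_ = ?R")
  proof (intro set_eqI)
    fix q :: "(real ^ 'a) \<times> real"
    obtain x t where q: "q = (x, t)"
      by fastforce
    have "\<forall>j\<in>I. p $ j \<in> \<int>"
      using p by (simp add: X_MO_def)
    then show "q \<in> P \<longleftrightarrow> q \<in> ?R"
      unfolding q
      by (auto simp: P_def feas_def X_MO_def vec_eq_iff matrix_vector_mul_component inner_axis'
          less_eq_vec_def rows1l_def algebra_simps)
  qed
  moreover have "polyhedron ?R"
    by (intro polyhedron_Int polyhedron_Inter)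
       (auto intro: polyhedron_halfspace_le polyhedron_halfspace_ge polyhedron_hyperplane)
  moreover have "P \<subseteq> X_MO A b I \<times> {0..1}"
    by (auto simp: P_def feas_def)
  then have "bounded P"
    using assms(1) bounded_Times bounded_closed_interval bounded_subset by metis
  ultimately have P: "polytope P"
    by (simp add: polytope_eq_bounded_polyhedron)
  have lin: "linear (\<lambda>q. (snd q, obj0 C (fst q)))"
    by (rule linearI) (simp_all add: obj0_def inner_add_right)
  have "ray_costs A b I C \<zeta> d p = (\<lambda>q. (snd q, obj0 C (fst q))) ` P"
    by (force simp: ray_costs_def P_def image_iff)
  with polytope_linear_image[OF lin P] show ?thesis
    by simp
qed

lemma rvf_along_ray:
  assumes "K \<subseteq> X_MO A b I"
    and "\<And>x. x \<in> X_MO A b I \<Longrightarrow> \<exists>p\<in>K. \<forall>j\<in>I. x $ j = p $ j"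
    and "0 \<le> t" "t \<le> 1"
  shows "rvf A b I C (\<zeta> + t *\<^sub>R d) = (INF p\<in>K. lower_boundary (ray_costs A b I C \<zeta> d p) t)"
proof (rule antisym)
  show "rvf A b I C (\<zeta> + t *\<^sub>R d) \<le> (INF p\<in>K. lower_boundary (ray_costs A b I C \<zeta> d p) t)"
    unfolding rvf_def lower_boundary_def
    by (auto simp: ray_costs_def intro!: INF_greatest INF_lower)
  show "(INF p\<in>K. lower_boundary (ray_costs A b I C \<zeta> d p) t) \<le> rvf A b I C (\<zeta> + t *\<^sub>R d)"
    unfolding rvf_def
  proof (rule INF_greatest)
    fix x assume x: "x \<in> feas A b I C (\<zeta> + t *\<^sub>R d)"
    then obtain p where p: "p \<in> K" "\<forall>j\<in>I. x $ j = p $ j"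
      using assms(2) by (auto simp: feas_def)
    then have "(t, obj0 C x) \<in> ray_costs A b I C \<zeta> d p"
      using x assms(3,4) by (auto simp: ray_costs_def)
    then have "lower_boundary (ray_costs A b I C \<zeta> d p) t \<le> ereal (obj0 C x)"
      unfolding lower_boundary_def by (intro INF_lower) auto
    with p(1) show "(INF p\<in>K. lower_boundary (ray_costs A b I C \<zeta> d p) t) \<le> ereal (obj0 C x)"
      by (rule INF_lower2)
  qed
qed

text \<open>
  The hypothesis demands only a strictly larger cost at each \<open>t > 0\<close>, without any rate; the rate
  comes from the polytopes.
\<close>

lemma dir_deriv_rvf_positive:
  assumes "bounded (X_MO A b I)" and z: "rvf A b I C \<zeta> = ereal z"
    and gt: "\<And>t x. 0 < t \<Longrightarrow> x \<in> feas A b I C (\<zeta> + t *\<^sub>R d) \<Longrightarrow> z < obj0 C x"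
  shows "\<exists>D>0. has_dir_deriv (rvf A b I C) \<zeta> d D"
proof -
  obtain K where K: "finite K" "K \<subseteq> X_MO A b I"
      "\<And>x. x \<in> X_MO A b I \<Longrightarrow> \<exists>p\<in>K. \<forall>j\<in>I. x $ j = p $ j"
    using finite_integer_representatives[OF assms(1), of I] by (auto simp: X_MO_def)
  define g where "g p = lower_boundary (ray_costs A b I C \<zeta> d p)" for p
  have ge: "z \<le> obj0 C x" if "x \<in> feas A b I C \<zeta>" for x
    using INF_lower[OF that, of "\<lambda>x. ereal (obj0 C x)"] z by (simp add: rvf_def)
  have "\<exists>D>0. ((\<lambda>t. (g p t - ereal z) / ereal t) \<longlongrightarrow> D) (at_right 0)"
    if "p \<in> K" for p
  proof (rule lower_boundary_slope_positive[of "ray_costs A b I C \<zeta> d p" z])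
    show "polytope (ray_costs A b I C \<zeta> d p)"
      using polytope_ray_costs assms(1) K(2) that by blast
  qed (use ge gt in \<open>auto simp: ray_costs_def g_def\<close>)
  with K(1) obtain D where D: "D > 0"
      "((\<lambda>t. ((INF p\<in>K. g p t) - ereal z) / ereal t) \<longlongrightarrow> D) (at_right 0)"
    using INF_slope_positive[of K g z] by blast
  have "eventually (\<lambda>t. ((INF p\<in>K. g p t) - ereal z) / ereal t =
      (rvf A b I C (\<zeta> + t *\<^sub>R d) - rvf A b I C \<zeta>) / ereal t) (at_right 0)"
    by (rule eventually_at_rightI[of 0 1]) (auto simp: rvf_along_ray[OF K(2,3)] g_def z)
  from Lim_transform_eventually[OF D(2) this] D(1) show ?thesis
    unfolding has_dir_deriv_def by blast
qed

section \<open>Efficient solutions and the restricted value function\<close>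

lemma dominates_criterion_iff:
  "dominates (C *v x') (C *v x) \<longleftrightarrow>
     obj0 C x' \<le> obj0 C x \<and> rows1l C *v x' \<le> rows1l C *v x \<and>
     (obj0 C x' < obj0 C x \<or> rows1l C *v x' \<noteq> rows1l C *v x)"
  by (auto simp: dominates_def split_option_all split_option_ex obj0_def rows1l_def
      matrix_vector_mul_component less_eq_vec_def vec_eq_iff order_less_le)

lemma efficient_iff:
  "efficient A b I C x \<longleftrightarrow>
     x \<in> X_MO A b I \<and> (\<forall>x'\<in>X_MO A b I. \<not> dominates (C *v x') (C *v x))"
  unfolding efficient_def efficient_frontier_def by fastforce

lemma as_epi_point_criterion: "as_epi_point (C *v x) = (rows1l C *v x, obj0 C x)"
  by (simp add: as_epi_point_def obj0_def rows1l_def matrix_vector_mul_component vec_eq_iff)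

lemma efficient_frontier_eq: "efficient_frontier A b I C = {C *v x | x. efficient A b I C x}"
  by (auto simp: efficient_frontier_def efficient_iff)

lemma rvf_efficient:
  assumes "efficient A b I C x"
  shows "rvf A b I C (rows1l C *v x) = ereal (obj0 C x)"
  unfolding rvf_def
proof (rule antisym)
  show "(INF y\<in>feas A b I C (rows1l C *v x). ereal (obj0 C y)) \<le> ereal (obj0 C x)"
    using assms by (intro INF_lower) (auto simp: efficient_iff feas_def)
  have "obj0 C x \<le> obj0 C y" if "y \<in> feas A b I C (rows1l C *v x)" for y
    using assms that by (force simp: efficient_iff feas_def dominates_criterion_iff)
  then show "ereal (obj0 C x) \<le> (INF y\<in>feas A b I C (rows1l C *v x). ereal (obj0 C y))"
    by (intro INF_greatest) auto
qed

lemma efficient_in_epi_boundary: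
  assumes "efficient A b I C x"
  shows "(rows1l C *v x, obj0 C x) \<in> epi_boundary A b I C"
  using assms rvf_efficient[OF assms]
  by (auto simp: epi_boundary_def vf_dom_def feas_def efficient_iff)

lemma compact_feas:
  assumes "bounded (X_MO A b I)"
  shows "compact (feas A b I C \<zeta>)"
proof -
  have "feas A b I C \<zeta> = {x. A *v x = b} \<inter> (\<Inter>j. {x. 0 \<le> x $ j}) \<inter>
      (\<Inter>j\<in>I. {x. x $ j \<in> \<int>}) \<inter> (\<Inter>k. {x. (rows1l C *v x) $ k \<le> \<zeta> $ k})"
    by (auto simp: feas_def X_MO_def less_eq_vec_def)
  also have "closed \<dots>"
    by (intro closed_Int closed_INT ballI closed_Collect_eq closed_Collect_le continuous_intros
        matrix_vector_mult_linear_continuous_on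
        closed_vimage[OF closed_Ints, unfolded vimage_def])
  finally have "closed (feas A b I C \<zeta>)" .
  moreover have "bounded (feas A b I C \<zeta>)"
    using assms by (rule bounded_subset) (auto simp: feas_def)
  ultimately show ?thesis
    by (simp add: compact_eq_bounded_closed)
qed

text \<open>
  A minimizer of objective 0 need not be efficient, since another one may improve the remaining
  objectives. Minimizing their sum among all minimizers rules this out: a dominating solution would
  again be feasible for \<open>\<zeta>\<close> and optimal for objective 0, with a strictly smaller sum.
\<close>

lemma efficient_minimizer_exists:
  assumes "bounded (X_MO A b I)" and "\<zeta> \<in> vf_dom A b I C"
  obtains x where "efficient A b I C x" "ereal (obj0 C x) = rvf A b I C \<zeta>" "rows1l C *v x \<le> \<zeta>"
proof -
  let ?S = "feas A b I C \<zeta>"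
  have cont: "continuous_on S (obj0 C)" for S
    unfolding obj0_def by (intro continuous_intros)
  obtain y where y: "y \<in> ?S" "\<And>x. x \<in> ?S \<Longrightarrow> obj0 C y \<le> obj0 C x"
    using continuous_attains_inf[OF compact_feas[OF assms(1)] _ cont, of C \<zeta>] assms(2)
    by (auto simp: vf_dom_def)
  define T where "T = ?S \<inter> {x. obj0 C x \<le> obj0 C y}"
  define f where "f x = (\<Sum>k\<in>UNIV. (rows1l C *v x) $ k)" for x
  have "compact T"
    unfolding T_def
    by (intro compact_Int_closed compact_feas assms(1) closed_Collect_le cont continuous_on_const)
  moreover have "y \<in> T"
    using y(1) by (simp add: T_def)
  moreover have "continuous_on T f"
    unfolding f_def by (intro continuous_intros matrix_vector_mult_linear_continuous_on)
  ultimately obtain x where x: "x \<in> T" "\<And>u. u \<in> T \<Longrightarrow> f x \<le> f u"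
    using continuous_attains_inf[of T f] by blast
  have xS: "x \<in> ?S" and obj: "obj0 C x = obj0 C y"
    using x(1) y(2) by (auto simp: T_def intro: antisym)
  show thesis
  proof
    show "rows1l C *v x \<le> \<zeta>"
      using xS by (simp add: feas_def)
    show "ereal (obj0 C x) = rvf A b I C \<zeta>"
      unfolding rvf_def
      using xS y(2) unfolding obj[symmetric]
      by (intro antisym INF_greatest INF_lower) auto
    show "efficient A b I C x"
      unfolding efficient_iff
    proof (intro conjI ballI notI)
      show "x \<in> X_MO A b I"
        using xS by (simp add: feas_def)
      fix u assume u: "u \<in> X_MO A b I" and dom: "dominates (C *v u) (C *v x)"
      have "u \<in> ?S"
        using u dom xS by (auto simp: feas_def dominates_criterion_iff)
      then have ge: "obj0 C x \<le> obj0 C u"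
        using y(2) obj by simp
      then have "u \<in> T"
        using \<open>u \<in> ?S\<close> dom obj by (auto simp: T_def dominates_criterion_iff)
      have le: "rows1l C *v u \<le> rows1l C *v x" and "rows1l C *v u \<noteq> rows1l C *v x"
        using dom ge by (auto simp: dominates_criterion_iff)
      then have "f u < f x"
        unfolding f_def
        by (intro sum_strict_mono_ex1) (auto simp: less_eq_vec_def vec_eq_iff order_less_le)
      with x(2)[OF \<open>u \<in> T\<close>] show False
        by simp
    qed
  qed
qed

text \<open>
  The value is constant on the segment from \<open>\<zeta>\<close> to the objectives 1 to l of \<open>x\<close>: it cannot
  decrease since the bounds become tighter, and \<open>x\<close> remains feasible throughout.
\<close>

lemma dir_deriv_towards_slack_zero:
  assumes x: "x \<in> X_MO A b I" "ereal (obj0 C x) = rvf A b I C \<zeta>" "rows1l C *v x \<le> \<zeta>"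
    and D: "has_dir_deriv (rvf A b I C) \<zeta> (rows1l C *v x - \<zeta>) D"
  shows "D = 0"
proof -
  let ?d = "rows1l C *v x - \<zeta>"
  have "eventually (\<lambda>t. 0 = (rvf A b I C (\<zeta> + t *\<^sub>R ?d) - rvf A b I C \<zeta>) / ereal t) (at_right 0)"
  proof (rule eventually_at_rightI[of 0 1])
    fix t :: real assume t: "t \<in> {0<..<1}"
    have le: "\<zeta> + t *\<^sub>R ?d \<le> \<zeta>"
      using x(3) t by (auto simp: less_eq_vec_def mult_le_0_iff)
    have "(1 - t) * (rows1l C *v x) $ k \<le> (1 - t) * \<zeta> $ k" for k
      using x(3) t by (intro mult_left_mono) (auto simp: less_eq_vec_def)
    then have "rows1l C *v x \<le> \<zeta> + t *\<^sub>R ?d"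
      by (simp add: less_eq_vec_def algebra_simps)
    then have "rvf A b I C (\<zeta> + t *\<^sub>R ?d) \<le> rvf A b I C \<zeta>"
      unfolding rvf_def[of A b I C "\<zeta> + t *\<^sub>R ?d"] x(2)[symmetric]
      using x(1) by (intro INF_lower) (simp add: feas_def)
    moreover have "rvf A b I C \<zeta> \<le> rvf A b I C (\<zeta> + t *\<^sub>R ?d)"
      unfolding rvf_def using order_trans[OF _ le] by (intro INF_superset_mono) (auto simp: feas_def)
    ultimately have "rvf A b I C (\<zeta> + t *\<^sub>R ?d) = ereal (obj0 C x)"
      using x(2) by simp
    then show "0 = (rvf A b I C (\<zeta> + t *\<^sub>R ?d) - rvf A b I C \<zeta>) / ereal t"
      using t by (simp flip: x(2) add: zero_ereal_def)
  qed simp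
  from Lim_transform_eventually[OF tendsto_const this]
  show ?thesis
    using D tendsto_unique trivial_limit_at_right_real unfolding has_dir_deriv_def by blast
qed

lemma criterion_tight_iff_dir_deriv_positive:
  assumes bdd: "bounded (X_MO A b I)"
    and eff: "efficient A b I C x" and val: "ereal (obj0 C x) = rvf A b I C \<zeta>"
    and le: "rows1l C *v x \<le> \<zeta>"
  shows "rows1l C *v x = \<zeta> \<longleftrightarrow>
    (\<forall>d. d \<le> 0 \<and> d \<noteq> 0 \<longrightarrow> (\<exists>D. has_dir_deriv (rvf A b I C) \<zeta> d D \<and> D > 0))"
proof (intro iffI allI impI)
  fix d :: "real ^ 'c" assume eq: "rows1l C *v x = \<zeta>" and d: "d \<le> 0 \<and> d \<noteq> 0"
  have "obj0 C x < obj0 C u" if t: "0 < t" and u: "u \<in> feas A b I C (\<zeta> + t *\<^sub>R d)" for t u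
  proof (rule ccontr)
    assume "\<not> obj0 C x < obj0 C u"
    \<comment> \<open>\<open>u\<close> meets bounds that are strictly tighter somewhere, so it dominates \<open>x\<close>\<close>
    have below: "\<zeta> + t *\<^sub>R d \<le> \<zeta>"
      using d t by (auto simp: less_eq_vec_def mult_le_0_iff)
    moreover have "\<zeta> + t *\<^sub>R d \<noteq> \<zeta>"
      using d t by simp
    ultimately have "rows1l C *v u \<le> rows1l C *v x" "rows1l C *v u \<noteq> rows1l C *v x"
      unfolding eq using u order_trans[of "rows1l C *v u" "\<zeta> + t *\<^sub>R d" \<zeta>] antisym[of "\<zeta> + t *\<^sub>R d" \<zeta>]
      by (auto simp: feas_def simp del: le_add_same_cancel1 add_le_same_cancel1)
    then have "dominates (C *v u) (C *v x)"
      using \<open>\<not> obj0 C x < obj0 C u\<close> by (simp add: dominates_criterion_iff)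
    then show False
      using eff u by (auto simp: efficient_iff feas_def)
  qed
  then have "\<exists>D>0. has_dir_deriv (rvf A b I C) \<zeta> d D"
    by (rule dir_deriv_rvf_positive[OF bdd val[symmetric]])
  then show "\<exists>D. has_dir_deriv (rvf A b I C) \<zeta> d D \<and> D > 0"
    by blast
next
  assume pos: "\<forall>d. d \<le> 0 \<and> d \<noteq> 0 \<longrightarrow> (\<exists>D. has_dir_deriv (rvf A b I C) \<zeta> d D \<and> D > 0)"
  show "rows1l C *v x = \<zeta>"
  proof (rule ccontr)
    assume "rows1l C *v x \<noteq> \<zeta>"
    moreover have "rows1l C *v x - \<zeta> \<le> 0"
      using le by (simp add: less_eq_vec_def)
    ultimately obtain D where "has_dir_deriv (rvf A b I C) \<zeta> (rows1l C *v x - \<zeta>) D" "D > 0"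
      using pos by fastforce
    moreover have "x \<in> X_MO A b I"
      using eff by (simp add: efficient_iff)
    ultimately show False
      using dir_deriv_towards_slack_zero val le by fastforce
  qed
qed

text \<open>
  The instance is \<open>\<Sum> x\<^sub>j = 0\<close>, \<open>x \<ge> 0\<close> with zero objectives, which works for any number
  of variables, constraints and objectives. Its only criterion vector is 0, but the graph of the
  value function lies over all \<open>\<zeta> \<ge> 0\<close>.
\<close>

lemma frontier_strict_subset_example:
  obtains A :: "real ^ 'n ^ 'm" and b :: "real ^ 'm" and I :: "'n set"
    and C :: "real ^ 'n ^ ('l::finite) option"
  where "mo_instance A b I C" "as_epi_point ` efficient_frontier A b I C \<subset> epi_boundary A b I C"
proof -
  define A :: "real ^ 'n ^ 'm" where "A = (\<chi> i j. 1)"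
  define C :: "real ^ 'n ^ 'l option" where "C = 0"
  have "A *v x = 0 \<longleftrightarrow> (\<Sum>j\<in>UNIV. x $ j) = 0" for x
    by (simp add: A_def matrix_vector_mult_def vec_eq_iff)
  then have X: "X_MO A 0 {} = {0}"
    by (auto simp: X_MO_def vec_eq_iff sum_nonneg_eq_0_iff)
  have C: "obj0 C x = 0" "rows1l C *v x = 0" "C *v x = 0" for x
    by (simp_all add: C_def obj0_def rows1l_def vec_eq_iff matrix_vector_mult_def)
  have inst: "mo_instance A 0 {} C"
    unfolding mo_instance_def X
    by (simp add: rational_mat_def rational_vec_def A_def C_def)
  have "(1, 0) \<in> epi_boundary A 0 {} C"
    by (auto simp: epi_boundary_def vf_dom_def rvf_def feas_def X C less_eq_vec_def)
  moreover have "as_epi_point ` efficient_frontier A 0 {} C \<subseteq> {(0, 0)}"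
    using as_epi_point_criterion[of C] by (auto simp: efficient_frontier_eq C)
  moreover have "as_epi_point ` efficient_frontier A 0 {} C \<subseteq> epi_boundary A 0 {} C"
    by (auto simp: efficient_frontier_eq as_epi_point_criterion efficient_in_epi_boundary)
  moreover have "(1 :: real ^ 'l) \<noteq> 0"
    by simp
  ultimately have "as_epi_point ` efficient_frontier A 0 {} C \<subset> epi_boundary A 0 {} C"
    by blast
  with inst show thesis
    by (rule that)
qed

theorem theorem2:
  fixes A :: "real ^ 'n ^ 'm" and b :: "real ^ 'm" and I :: "'n set"
    and C :: "real ^ 'n ^ ('l::finite) option"
  assumes "mo_instance A b I C"
  shows
    "as_epi_point ` efficient_frontier A b I C \<subseteq> epi_boundary A b I C \<and>
     (\<exists>(A' :: real ^ 'n ^ 'm) (b' :: real ^ 'm) (I' :: 'n set) (C' :: real ^ 'n ^ 'l option).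
       mo_instance A' b' I' C' \<and>
       as_epi_point ` efficient_frontier A' b' I' C' \<subset> epi_boundary A' b' I' C') \<and>
     (\<forall>x\<in>X_MO A b I. C *v x \<in> efficient_frontier A b I C \<longrightarrow>
       (rows1l C *v x, obj0 C x) \<in> epi_boundary A b I C \<and>
       rvf A b I C (rows1l C *v x) = ereal (obj0 C x)) \<and>
     (\<forall>\<zeta>\<in>vf_dom A b I C.
       (\<exists>x. efficient A b I C x \<and> ereal (obj0 C x) = rvf A b I C \<zeta> \<and> rows1l C *v x \<le> \<zeta>) \<and>
       (\<forall>x. efficient A b I C x \<and> ereal (obj0 C x) = rvf A b I C \<zeta> \<and> rows1l C *v x \<le> \<zeta> \<longrightarrow>
          (rows1l C *v x = \<zeta> \<longleftrightarrow>
           (\<forall>d. d \<le> 0 \<and> d \<noteq> 0 \<longrightarrow>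
             (\<exists>D. has_dir_deriv (rvf A b I C) \<zeta> d D \<and> D > 0)))))"
proof -
  have bdd: "bounded (X_MO A b I)"
    using assms by (simp add: mo_instance_def)
  have "as_epi_point ` efficient_frontier A b I C \<subseteq> epi_boundary A b I C"
    by (auto simp: efficient_frontier_eq as_epi_point_criterion efficient_in_epi_boundary)
  moreover have "(rows1l C *v x, obj0 C x) \<in> epi_boundary A b I C \<and>
      rvf A b I C (rows1l C *v x) = ereal (obj0 C x)"
    if "x \<in> X_MO A b I" "C *v x \<in> efficient_frontier A b I C" for x
    using efficient_in_epi_boundary rvf_efficient that unfolding efficient_def by blast
  moreover have "\<exists>(A' :: real ^ 'n ^ 'm) (b' :: real ^ 'm) (I' :: 'n set) (C' :: real ^ 'n ^ 'l option).
      mo_instance A' b' I' C' \<and>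
      as_epi_point ` efficient_frontier A' b' I' C' \<subset> epi_boundary A' b' I' C'"
    using frontier_strict_subset_example by metis
  moreover have "\<exists>x. efficient A b I C x \<and> ereal (obj0 C x) = rvf A b I C \<zeta> \<and> rows1l C *v x \<le> \<zeta>"
    if "\<zeta> \<in> vf_dom A b I C" for \<zeta>
    using efficient_minimizer_exists[OF bdd that] by metis
  ultimately show ?thesis
    using criterion_tight_iff_dir_deriv_positive[OF bdd]
    by (intro conjI ballI allI impI) (assumption | elim conjE | simp)+
qed

end
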